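(* Let $\mathfrak{g}$ be a finite dimensional Lie algebra over $\mathbb{R}$ or $\mathbb{C}$ and let $0\neq\mathfrak{g}_0\subset\mathfrak{g}$ be a subalgebra such that the pair $(\mathfrak{g},\mathfrak{g}_0)$ is effective, with order $o(\mathfrak{g},\mathfrak{g}_0)$. Suppose $\mathfrak{g}$ is $k$-step nilpotent, i.e., $\mathfrak{g}_{(k-1)}\neq 0$ but $\mathfrak{g}_{(k)}=0$. Then $o(\mathfrak{g},\mathfrak{g}_0)\leq k+1$.
   Context: All Lie algebras are finite dimensional over $\mathbb{R}$ or $\mathbb{C}$. A pair $(\mathfrak{g},\mathfrak{g}_0)$ consisting of a Lie algebra $\mathfrak{g}$ and a subalgebra $\mathfrak{g}_0\subset\mathfrak{g}$ is called effective if $\mathfrak{g}_0$ contains no nonzero ideal of $\mathfrak{g}$. Starting from $\mathfrak{g}_0$, define inductively for $k\geq 0$ $$\mathfrak{g}_{k+1}=\{x\in\mathfrak{g}_k\mid [x,\mathfrak{g}]\subset\mathfrak{g}_k\}.$$ This gives a descending chain $\mathfrak{g}\supset\mathfrak{g}_0\supset\mathfrak{g}_1\supset\cdots$, which reaches $\{0\}$ when the pair is effective. The order $o(\mathfrak{g},\mathfrak{g}_0)$ is the smallest integer $r\geq 0$ with $\mathfrak{g}_r=\{0\}$. The lower central series of $\mathfrak{g}$ is denoted with parentheses and indexed from $0$: $\mathfrak{g}_{(0)}=\mathfrak{g}$ and $\mathfrak{g}_{(k+1)}=[\mathfrak{g}_{(k)},\mathfrak{g}]$. *)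

theory Defs
  imports Complex_Main
begin

definition real_or_complex_field :: "'k::field itself \<Rightarrow> bool" where
  "real_or_complex_field _ \<longleftrightarrow>
     (\<exists>f :: 'k \<Rightarrow> real. bij f \<and> f 1 = 1 \<and>
        (\<forall>a b. f (a + b) = f a + f b) \<and> (\<forall>a b. f (a * b) = f a * f b)) \<or>
     (\<exists>f :: 'k \<Rightarrow> complex. bij f \<and> f 1 = 1 \<and>
        (\<forall>a b. f (a + b) = f a + f b) \<and> (\<forall>a b. f (a * b) = f a * f b))"

locale lie_algebra = vector_space scale
  for scale :: "'k::field \<Rightarrow> 'g::ab_group_add \<Rightarrow> 'g" +
  fixes bracket :: "'g \<Rightarrow> 'g \<Rightarrow> 'g"
  assumes linear_left: "Vector_Spaces.linear scale scale (\<lambda>x. bracket x y)"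
    and linear_right: "Vector_Spaces.linear scale scale (\<lambda>y. bracket x y)"
    and alternating: "bracket x x = 0"
    and jacobi: "bracket x (bracket y z) + bracket y (bracket z x) + bracket z (bracket x y) = 0"
begin

definition subalgebra :: "'g set \<Rightarrow> bool" where
  "subalgebra h \<longleftrightarrow> subspace h \<and> (\<forall>x\<in>h. \<forall>y\<in>h. bracket x y \<in> h)"

definition lie_ideal :: "'g set \<Rightarrow> bool" where
  "lie_ideal I \<longleftrightarrow> subspace I \<and> (\<forall>x\<in>I. \<forall>y. bracket x y \<in> I)"

definition effective_pair :: "'g set \<Rightarrow> bool" where
  "effective_pair h \<longleftrightarrow> subalgebra h \<and> (\<forall>I. lie_ideal I \<and> I \<subseteq> h \<longrightarrow> I = {0})"

primrec filtration :: "'g set \<Rightarrow> nat \<Rightarrow> 'g set" where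
  "filtration h 0 = h"
| "filtration h (Suc n) = {x \<in> filtration h n. \<forall>y. bracket x y \<in> filtration h n}"

text \<open>For an effective pair in finite dimension the filtration reaches \<open>{0}\<close>, so this minimum
  exists; for other pairs the value may be unspecified.\<close>

definition pair_order :: "'g set \<Rightarrow> nat" where
  "pair_order h = (LEAST r. filtration h r = {0})"

definition bracket_span :: "'g set \<Rightarrow> 'g set \<Rightarrow> 'g set" where
  "bracket_span A B = span {bracket x y | x y. x \<in> A \<and> y \<in> B}"

primrec lower_central :: "nat \<Rightarrow> 'g set" where
  "lower_central 0 = UNIV"
| "lower_central (Suc n) = bracket_span (lower_central n) UNIV"

definition step_nilpotent :: "nat \<Rightarrow> bool" where
  "step_nilpotent k \<longleftrightarrow> k \<ge> 1 \<and> lower_central (k - 1) \<noteq> {0} \<and> lower_central k = {0}"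

end

locale finite_dimensional_lie_algebra = lie_algebra +
  assumes finite_dimensional: "\<exists>B. finite_dimensional_vector_space scale B"

end

theory Submission
  imports Defs
begin

text \<open>
  An element lies in the \<open>n\<close>-th term of the filtration exactly when it and all its iterated
  brackets \<open>[\<dots>[[x, y\<^sub>1], y\<^sub>2], \<dots>, y\<^sub>j]\<close> with \<open>j \<le> n\<close> lie in the subalgebra. If the algebra is
  \<open>k\<close>-step nilpotent, the iterated brackets with \<open>k\<close> entries \<open>y\<^sub>i\<close> all vanish, so membership in
  the term of index \<open>k - 1\<close> already implies membership in the term of index \<open>k\<close>: the filtration
  is stationary there (\<open>filtration_stationary\<close>). A stationary term absorbs brackets, so it is an
  ideal inside the subalgebra, and effectiveness makes it zero
  (\<open>stationary_filtration_eq_zero\<close>). This yields the bound \<open>k - 1\<close>, which is sharper than the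
  bound \<open>k + 1\<close> of the theorem.
\<close>

context lie_algebra
begin

lemma subspace_filtration:
  assumes "subspace h"
  shows "subspace (filtration h n)"
proof (induction n)
  case 0
  then show ?case using assms by simp
next
  case (Suc n)
  have "bracket 0 y = 0"
    and "bracket (a + b) y = bracket a y + bracket b y"
    and "bracket (scale c a) y = scale c (bracket a y)" for a b c y
  proof -
    interpret L: Vector_Spaces.linear scale scale "\<lambda>x. bracket x y"
      by (rule linear_left)
    show "bracket 0 y = 0"
      and "bracket (a + b) y = bracket a y + bracket b y"
      and "bracket (scale c a) y = scale c (bracket a y)"
      by (fact L.zero L.add L.scale)+
  qed
  then show ?case
    using Suc by (simp add: subspace_def)
qed

lemma filtration_subset: "filtration h n \<subseteq> h"
  by (induction n) auto

lemma bracket_lower_central: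
  assumes "x \<in> lower_central i"
  shows "bracket x y \<in> lower_central (Suc i)"
  using assms by (auto simp: bracket_span_def intro!: span_base)

text \<open>
  Being in the \<open>i\<close>-th term of the lower central series and being in the \<open>n\<close>-th term of the
  filtration trade off: bracketing raises the first index and lowers the second, which is why
  the induction on \<open>n\<close> needs \<open>i\<close> arbitrary and only \<open>i + n\<close> fixed.
\<close>

lemma lower_central_filtration_Suc:
  assumes "subspace h" and "lower_central (Suc (i + n)) = {0}"
    and "x \<in> lower_central i" and "x \<in> filtration h n"
  shows "x \<in> filtration h (Suc n)"
  using assms(2-)
proof (induction n arbitrary: i x)
  case 0
  have "bracket x y = 0" for y
    using bracket_lower_central[OF "0.prems"(2), of y] "0.prems"(1) by simp
  then show ?case
    using 0 subspace_0[OF assms(1)] by simp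
next
  case (Suc n)
  have "bracket x y \<in> filtration h (Suc n)" for y
  proof (rule Suc.IH)
    show "lower_central (Suc (Suc i + n)) = {0}"
      using Suc.prems(1) by simp
    show "bracket x y \<in> lower_central (Suc i)"
      using Suc.prems(2) by (rule bracket_lower_central)
    show "bracket x y \<in> filtration h n"
      using Suc.prems(3) by simp
  qed
  then show ?case
    using Suc.prems(3) by (simp del: filtration.simps add: filtration.simps(2)[of h "Suc n"])
qed

lemma filtration_stationary:
  assumes "subspace h" and "lower_central (Suc n) = {0}"
  shows "filtration h n \<subseteq> filtration h (Suc n)"
proof
  fix x
  assume "x \<in> filtration h n"
  with assms show "x \<in> filtration h (Suc n)"
    by (intro lower_central_filtration_Suc[where i = 0]) simp_all
qed

lemma stationary_filtration_eq_zero: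
  assumes "effective_pair h" and "filtration h n \<subseteq> filtration h (Suc n)"
  shows "filtration h n = {0}"
proof -
  have "subspace (filtration h n)"
    using assms(1) by (intro subspace_filtration) (simp add: effective_pair_def subalgebra_def)
  moreover have "bracket x y \<in> filtration h n" if "x \<in> filtration h n" for x y
    using assms(2) that by auto
  ultimately have "lie_ideal (filtration h n)"
    by (simp add: lie_ideal_def)
  then show ?thesis
    using assms(1) filtration_subset by (simp add: effective_pair_def)
qed

theorem pair_order_le_nilpotency_step:
  assumes "effective_pair h" and "step_nilpotent k"
  shows "pair_order h \<le> k - 1"
proof -
  have "lower_central (Suc (k - 1)) = {0}"
    using assms(2) by (simp del: lower_central.simps add: step_nilpotent_def)
  then have "filtration h (k - 1) \<subseteq> filtration h (Suc (k - 1))"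
    using assms(1) by (intro filtration_stationary) (simp_all add: effective_pair_def subalgebra_def)
  then have "filtration h (k - 1) = {0}"
    by (rule stationary_filtration_eq_zero[OF assms(1)])
  then show ?thesis
    unfolding pair_order_def by (rule Least_le)
qed

end

theorem corollary7:
  fixes scale :: "'k::field \<Rightarrow> 'g::ab_group_add \<Rightarrow> 'g"
    and bracket :: "'g \<Rightarrow> 'g \<Rightarrow> 'g"
    and g0 :: "'g set"
    and k :: nat
  assumes "real_or_complex_field TYPE('k)"
    and "finite_dimensional_lie_algebra scale bracket"
    and "lie_algebra.subalgebra scale bracket g0"
    and "g0 \<noteq> {0}"
    and "lie_algebra.effective_pair scale bracket g0"
    and "lie_algebra.step_nilpotent scale bracket k"
  shows "lie_algebra.pair_order bracket g0 \<le> k + 1"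
proof -
  interpret finite_dimensional_lie_algebra scale bracket
    by fact
  have "pair_order g0 \<le> k - 1"
    using assms(5,6) by (rule pair_order_le_nilpotency_step)
  then show ?thesis
    by simp
qed

end
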